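(* Let $\ell>0$ and $\gamma_1\in(0,\frac1\ell]$. Define the following points of $\mathbb{R}^2$: $$x=\begin{pmatrix}-\frac12\\0\end{pmatrix},\quad y=\begin{pmatrix}\frac12\\0\end{pmatrix},\quad x_{F_1}=\begin{pmatrix}-\frac{1}{2\gamma_1}\\ \frac{1}{2\gamma_1}\end{pmatrix},\quad y_{F_1}=\begin{pmatrix}-\frac{1-\gamma_1\ell}{2\gamma_1}\\ \frac{1+\gamma_1\ell}{2\gamma_1}\end{pmatrix},$$ $$x_{F_2}=\begin{pmatrix}-\frac{1-\gamma_1\ell}{2\gamma_1}\\ \frac{1}{2\gamma_1}\end{pmatrix},\quad y_{F_2}=\begin{pmatrix}-\frac{1-\gamma_1\ell}{2\gamma_1}\\ \frac{1-\gamma_1^2\ell^2}{2\gamma_1}\end{pmatrix}.$$ Then there exists an $\ell$-cocoercive operator $F:\mathbb{R}^2\to\mathbb{R}^2$ such that $F(x)=x_{F_1}$, $F(y)=y_{F_1}$, $F(x-\gamma_1x_{F_1})=x_{F_2}$, $F(y-\gamma_1y_{F_1})=y_{F_2}$, and for all $\gamma_2>0$ $$\left\|x-\gamma_2F\left(x-\gamma_1F(x)\right)-y+\gamma_2F\left(y-\gamma_1F(y)\right)\right\|>1=\|x-y\|.$$ That is, the operator $F_{\mathrm{EG},\gamma_1}:z\mapsto F(z-\gamma_1F(z))$ is non-cocoercive: it is not $\ell'$-cocoercive for any $\ell'>0$.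
   Context: $\langle\cdot,\cdot\rangle$ and $\|\cdot\|$ are the standard Euclidean inner product and norm. For $\ell>0$, an operator $G:\mathbb{R}^d\to\mathbb{R}^d$ is $\ell$-cocoercive if $\|G(z)-G(z')\|^2\le\ell\langle G(z)-G(z'),z-z'\rangle$ for all $z,z'\in\mathbb{R}^d$. *)

theory Defs
  imports "HOL-Analysis.Analysis"
begin

(* The norm and inner product of real ^ 'd are the standard Euclidean ones.
   The parameter l is meant to be positive; positivity is stated where the notion is used. *)
definition cocoercive :: "real \<Rightarrow> (real ^ 'd \<Rightarrow> real ^ 'd) \<Rightarrow> bool" where
  "cocoercive l G \<longleftrightarrow>
     (\<forall>z z'. (norm (G z - G z'))\<^sup>2 \<le> l * ((G z - G z') \<bullet> (z - z')))"

definition non_cocoercive :: "(real ^ 'd \<Rightarrow> real ^ 'd) \<Rightarrow> bool" where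
  "non_cocoercive G \<longleftrightarrow> (\<forall>l>0. \<not> cocoercive l G)"

definition eg_operator :: "real \<Rightarrow> (real ^ 'd \<Rightarrow> real ^ 'd) \<Rightarrow> real ^ 'd \<Rightarrow> real ^ 'd" where
  "eg_operator \<gamma> F z = F (z - \<gamma> *\<^sub>R F z)"

end

(* An operator F is l-cocoercive iff F = (l/2)(I + N) with N nonexpansive. The prescribed values
   force N to act on x, y and x - \<gamma>1 x_F1 as a rotation by 90 degrees, and on y - \<gamma>1 y_F1 as
   that rotation preceded by the reflection across the line {p - q = 1/2} through y and
   x - \<gamma>1 x_F1. So N is taken to be the rotation (with a translation) after folding the plane along
   this line. The images of x and y under the extragradient operator differ by a nonzero vector
   orthogonal to x - y, which gives the strict inequality and excludes cocoercivity. *)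
theory Submission
  imports Defs
begin

(* The fold is z \<mapsto> z - m (1, -1) with m = max 0 (p - q - 1/2). *)
definition fold_operator :: "real \<Rightarrow> real \<Rightarrow> real ^ 2 \<Rightarrow> real ^ 2" where
  "fold_operator l \<gamma> z =
     (let m = max 0 (z $ 1 - z $ 2 - 1 / 2) in
      vector [l / 2 * (z $ 1 - z $ 2 + 1 / 2 - m) - 1 / (2 * \<gamma>),
              l / 2 * (z $ 1 + z $ 2 + 1 / 2 - m) + 1 / (2 * \<gamma>)])"

lemma vec2_eq_iff: "(u :: real ^ 2) = v \<longleftrightarrow> u $ 1 = v $ 1 \<and> u $ 2 = v $ 2"
  by (simp add: vec_eq_iff forall_2)

lemma inner_vec2: "(u :: real ^ 2) \<bullet> v = u $ 1 * v $ 1 + u $ 2 * v $ 2"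
  by (simp add: inner_vec_def sum_2)

text \<open>Without the fold the inequality would be an equality. The fold leaves the gap
  \<open>l\<^sup>2 / 2 * k * (p - q - k)\<close>, where \<open>p\<close>, \<open>q\<close>,
  \<open>k\<close> are the increments of the two coordinates and of \<open>m\<close>.\<close>

lemma cocoercive_fold_operator: "cocoercive l (fold_operator l \<gamma>)"
  unfolding cocoercive_def
proof (intro allI)
  fix z z' :: "real ^ 2"
  define m where "m w = max 0 (w $ 1 - w $ 2 - 1 / 2)" for w :: "real ^ 2"
  define p q k where "p = z $ 1 - z' $ 1" and "q = z $ 2 - z' $ 2" and "k = m z - m z'"
  let ?D = "fold_operator l \<gamma> z - fold_operator l \<gamma> z'"
  have D: "?D $ 1 = l / 2 * (p - q - k)" "?D $ 2 = l / 2 * (p + q - k)"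
    by (simp_all add: fold_operator_def Let_def p_def q_def k_def m_def algebra_simps)
  \<comment> \<open>The map t \<mapsto> max 0 (t - 1/2) is nondecreasing and 1-Lipschitz, so
    \<open>k\<close> lies between 0 and \<open>p - q\<close>.\<close>
  have "k * k \<le> k * (p - q)"
  proof (cases "k \<ge> 0")
    case True
    moreover have "k \<le> p - q \<or> k \<le> 0"
      unfolding k_def m_def p_def q_def by (auto simp: max_def)
    ultimately show ?thesis
      by (metis mult_left_mono mult_zero_left order_antisym order_refl)
  next
    case False
    moreover have "p - q \<le> k \<or> 0 \<le> k"
      unfolding k_def m_def p_def q_def by (auto simp: max_def)
    ultimately show ?thesis
      by (intro mult_left_mono_neg) auto
  qed
  then have "l\<^sup>2 / 2 * (k * k) \<le> l\<^sup>2 / 2 * (k * (p - q))"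
    by (rule mult_left_mono) simp
  moreover have "l * (?D \<bullet> (z - z')) - (norm ?D)\<^sup>2 = l\<^sup>2 / 2 * (k * (p - q)) - l\<^sup>2 / 2 * (k * k)"
    unfolding power2_norm_eq_inner inner_vec2 D
    by (simp add: p_def [symmetric] q_def [symmetric] field_simps power2_eq_square)
  ultimately show "(norm ?D)\<^sup>2 \<le> l * (?D \<bullet> (z - z'))"
    by linarith
qed

text \<open>Orthogonality annihilates the right-hand side of the cocoercivity inequality whatever
  the constant, which would force the two images to coincide.\<close>

lemma non_cocoercive_orthogonal:
  assumes "G x \<noteq> G y" and "(G x - G y) \<bullet> (x - y) = 0"
  shows "non_cocoercive G"
  unfolding non_cocoercive_def cocoercive_def
proof (intro allI impI notI)
  fix l :: real
  assume "\<forall>z z'. (norm (G z - G z'))\<^sup>2 \<le> l * ((G z - G z') \<bullet> (z - z'))"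
  then have "(norm (G x - G y))\<^sup>2 \<le> l * ((G x - G y) \<bullet> (x - y))" by blast
  with assms show False by simp
qed

text \<open>Pythagoras: the added orthogonal leg is nonzero.\<close>

lemma norm_diff_scaleR_orthogonal_gt:
  fixes u v :: "'a :: real_inner"
  assumes "u \<bullet> v = 0" and "v \<noteq> 0" and "c \<noteq> 0"
  shows "norm u < norm (u - c *\<^sub>R v)"
proof -
  have "(norm (u - c *\<^sub>R v))\<^sup>2 = (norm u)\<^sup>2 + (norm (c *\<^sub>R v))\<^sup>2"
    using assms(1) by (simp add: power2_norm_eq_inner inner_diff inner_commute del: norm_scaleR)
  moreover have "0 < (norm (c *\<^sub>R v))\<^sup>2"
    using assms by simp
  ultimately have "(norm u)\<^sup>2 < (norm (u - c *\<^sub>R v))\<^sup>2"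
    by linarith
  then show ?thesis
    by (rule power2_less_imp_less) simp
qed

theorem theorem3p2:
  fixes l \<gamma>1 :: real
    and x y x_F1 y_F1 x_F2 y_F2 :: "real ^ 2"
  assumes "l > 0"
    and "0 < \<gamma>1" and "\<gamma>1 \<le> 1 / l"
    and "x = vector [- (1 / 2), 0]"
    and "y = vector [1 / 2, 0]"
    and "x_F1 = vector [- (1 / (2 * \<gamma>1)), 1 / (2 * \<gamma>1)]"
    and "y_F1 = vector [- ((1 - \<gamma>1 * l) / (2 * \<gamma>1)), (1 + \<gamma>1 * l) / (2 * \<gamma>1)]"
    and "x_F2 = vector [- ((1 - \<gamma>1 * l) / (2 * \<gamma>1)), 1 / (2 * \<gamma>1)]"
    and "y_F2 = vector [- ((1 - \<gamma>1 * l) / (2 * \<gamma>1)), (1 - \<gamma>1\<^sup>2 * l\<^sup>2) / (2 * \<gamma>1)]"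
  shows "\<exists>F :: real ^ 2 \<Rightarrow> real ^ 2.
           cocoercive l F
         \<and> F x = x_F1 \<and> F y = y_F1
         \<and> F (x - \<gamma>1 *\<^sub>R x_F1) = x_F2 \<and> F (y - \<gamma>1 *\<^sub>R y_F1) = y_F2
         \<and> (\<forall>\<gamma>2>0. norm (x - \<gamma>2 *\<^sub>R F (x - \<gamma>1 *\<^sub>R F x) - y + \<gamma>2 *\<^sub>R F (y - \<gamma>1 *\<^sub>R F y)) > 1)
         \<and> 1 = norm (x - y)
         \<and> non_cocoercive (eg_operator \<gamma>1 F)"
proof -
  let ?F = "fold_operator l \<gamma>1"
  \<comment> \<open>Both points have \<open>m\<close> = 0: \<open>x\<close> is on the side that the
    fold fixes and \<open>y\<close> is on the fold line.\<close>
  have Fx: "?F x = x_F1" and Fy: "?F y = y_F1"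
    using assms by (simp_all add: fold_operator_def vec2_eq_iff field_simps)
  \<comment> \<open>This point is also on the fold line, so again \<open>m\<close> = 0.\<close>
  have fold_x: "(x - \<gamma>1 *\<^sub>R x_F1) $ 1 = 0" "(x - \<gamma>1 *\<^sub>R x_F1) $ 2 = - 1 / 2"
    using assms by simp_all
  have Fx2: "?F (x - \<gamma>1 *\<^sub>R x_F1) = x_F2"
    unfolding fold_operator_def fold_x Let_def
    using assms by (simp add: vec2_eq_iff field_simps)
  \<comment> \<open>Here p - q - 1/2 = 1 whatever \<open>l\<close> and \<open>\<gamma>1\<close> are,
    so \<open>m\<close> = 1; this is the only one of the four points that the fold moves.\<close>
  have fold_y: "(y - \<gamma>1 *\<^sub>R y_F1) $ 1 = 1 - \<gamma>1 * l / 2" "(y - \<gamma>1 *\<^sub>R y_F1) $ 2 = - (1 + \<gamma>1 * l) / 2"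
    using assms by (simp_all add: field_simps)
  have Fy2: "?F (y - \<gamma>1 *\<^sub>R y_F1) = y_F2"
    unfolding fold_operator_def fold_y Let_def
    using assms by (simp add: vec2_eq_iff field_simps power2_eq_square)
  \<comment> \<open>This difference is vertical, whereas \<open>x - y\<close> is horizontal.\<close>
  have diff: "x_F2 - y_F2 = vector [0, \<gamma>1 * l\<^sup>2 / 2]"
    using assms(2) by (simp add: assms(8,9) vec2_eq_iff field_simps power2_eq_square)
  have orth: "(x - y) \<bullet> (x_F2 - y_F2) = 0"
    using assms(4,5) by (simp add: diff inner_vec2)
  have ne: "x_F2 - y_F2 \<noteq> 0"
    using assms(1,2) by (simp add: diff vec2_eq_iff)
  have norm_xy: "norm (x - y) = 1"
    using assms(4,5) by (simp add: norm_eq_1 inner_vec2)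
  have "norm (x - \<gamma>2 *\<^sub>R ?F (x - \<gamma>1 *\<^sub>R ?F x) - y + \<gamma>2 *\<^sub>R ?F (y - \<gamma>1 *\<^sub>R ?F y)) > 1"
    if "\<gamma>2 > 0" for \<gamma>2
  proof -
    have eq: "x - \<gamma>2 *\<^sub>R x_F2 - y + \<gamma>2 *\<^sub>R y_F2 = (x - y) - \<gamma>2 *\<^sub>R (x_F2 - y_F2)"
      by (simp add: algebra_simps)
    show ?thesis
      unfolding Fx Fy Fx2 Fy2 eq
      using norm_diff_scaleR_orthogonal_gt [OF orth ne, of \<gamma>2] that norm_xy by simp
  qed
  moreover have "non_cocoercive (eg_operator \<gamma>1 ?F)"
    using orth ne
    by (intro non_cocoercive_orthogonal [of _ x y])
      (simp_all add: eg_operator_def Fx Fy Fx2 Fy2 inner_commute)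
  ultimately show ?thesis
    using cocoercive_fold_operator Fx Fy Fx2 Fy2 norm_xy by metis
qed

end
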